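(* Let $n=2$, $x=(x_1,x_2)$, $\Delta=(2,1)$ and $\delta=(1,0)$. For every partition $\lambda=(\lambda_1,\lambda_2)$ of length at most $2$ (i.e. $\lambda\in\mathscr P^{(2)}$), the following two identities hold: \begin{align*} \sum_{\mu,\nu\in\mathscr P^{(2)}}c^\lambda_{\mu\nu}\,S_{2\mu+\Delta}(x)\,S_{2\nu+\Delta}(x)&=2^{-2}\,Q_{2\lambda+2\Delta}(x,x),\\ \sum_{\mu,\nu\in\mathscr P^{(2)}}c^\lambda_{\mu\nu}\,S_{2\mu+\delta}(x)\,S_{2\nu+\Delta}(x)&=2^{-2}\,Q_{2\lambda+\Delta+\delta}(x,x). \end{align*}
   Context: $\mathscr P^{(2)}$ is the set of partitions of length at most $2$, written as pairs $(\lambda_1,\lambda_2)$ of integers with $\lambda_1\ge\lambda_2\ge0$. Sums and integer multiples of partitions are taken componentwise, so $2\mu+\Delta=(2\mu_1+2,2\mu_2+1)$, $2\mu+\delta=(2\mu_1+1,2\mu_2)$, $2\lambda+2\Delta=(2\lambda_1+4,2\lambda_2+2)$, $2\lambda+\Delta+\delta=(2\lambda_1+3,2\lambda_2+1)$. Littlewood--Richardson coefficients: $c^\lambda_{\mu\nu}$ is defined by $s_\mu(x)s_\nu(x)=\sum_{\lambda\in\mathscr P^{(2)}}c^\lambda_{\mu\nu}s_\lambda(x)$, where $s_\lambda(x)$ is the Schur polynomial in the two variables $x_1,x_2$. The polynomials $q_r(x)$, $r\ge 0$, are defined by $\sum_{r\ge0}q_r(x)t^r=\prod_{i=1}^2\frac{1+x_it}{1-x_it}$,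 and $q_r(x)=0$ for $r<0$. The $2$-reduced Schur polynomial is $S_\lambda(x)=\det(q_{\lambda_i-i+j}(x))_{1\le i,j\le2}$ for $\lambda\in\mathscr P^{(2)}$. The polynomials $q_r(x,x)$ are defined by $\sum_{r\ge0}q_r(x,x)t^r=\prod_{i=1}^2\left(\frac{1+x_it}{1-x_it}\right)^2$. Schur's $Q$-polynomial (with doubled variables) for a two-part partition $(r,s)\neq(0,0)$ is $$Q_{(r,s)}(x,x)=q_r(x,x)q_s(x,x)+2\sum_{i=1}^s(-1)^iq_{r+i}(x,x)q_{s-i}(x,x).$$ *)

theory Defs
  imports
    "HOL-Library.Product_Plus"
    "HOL-Computational_Algebra.Formal_Power_Series"
    "HOL-Computational_Algebra.Polynomial"
    "Jordan_Normal_Form.Determinant"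
begin

section \<open>Partitions of length at most two\<close>

definition P2 :: "(nat \<times> nat) set" where
  "P2 = {(a, b). a \<ge> b}"

text \<open>Partitions are added componentwise by \<^theory>\<open>HOL-Library.Product_Plus\<close>; the
  multiple \<open>2\<mu>\<close> is defined here.  Rows and columns of matrices, and hence the parts of a
  partition and the variables, are numbered from 0.\<close>

definition dbl :: "nat \<times> nat \<Rightarrow> nat \<times> nat" where
  "dbl p = (2 * fst p, 2 * snd p)"

definition part :: "nat \<times> nat \<Rightarrow> nat \<Rightarrow> nat" where
  "part p i = (if i = 0 then fst p else snd p)"

definition Delta :: "nat \<times> nat" where
  "Delta = (2, 1)"

definition delta :: "nat \<times> nat" where
  "delta = (1, 0)"

section \<open>Schur polynomials and Littlewood--Richardson coefficients\<close>

text \<open>Polynomials in two variables are iterated univariate polynomials: in \<open>\<rat>[x\<^sub>1][x\<^sub>2]\<close>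
  the inner variable is \<open>x\<^sub>1\<close> and the outer one is \<open>x\<^sub>2\<close>.\<close>

type_synonym poly2 = "rat poly poly"

definition var :: "nat \<Rightarrow> poly2" where
  "var i = (if i = 0 then [:[:0, 1:]:] else [:0, 1:])"

text \<open>Bialternant \<open>det (x\<^sub>i ^ (\<lambda>\<^sub>j + n - j)) / det (x\<^sub>i ^ (n - j))\<close> with \<open>n = 2\<close>.  The division
  \<^const>\<open>divide\<close> of polynomials is exact here, see \<open>schur_mult_alternant\<close> below.\<close>

definition alternant :: "nat \<times> nat \<Rightarrow> poly2" where
  "alternant p = det (mat 2 2 (\<lambda>(i, j). var i ^ part p j))"

definition schur :: "nat \<times> nat \<Rightarrow> poly2" where
  "schur p = alternant (p + delta) div alternant delta"

text \<open>The unique family of coefficients in the expansion of \<open>s\<^sub>\<mu> s\<^sub>\<nu>\<close>; existence and uniqueness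
  are \<open>LR_expansion_ex1\<close> below.\<close>

definition LR_expansion :: "nat \<times> nat \<Rightarrow> nat \<times> nat \<Rightarrow> (nat \<times> nat \<Rightarrow> int) \<Rightarrow> bool" where
  "LR_expansion \<mu> \<nu> c \<longleftrightarrow>
     finite {\<kappa>. c \<kappa> \<noteq> 0} \<and> {\<kappa>. c \<kappa> \<noteq> 0} \<subseteq> P2 \<and>
     schur \<mu> * schur \<nu> = (\<Sum>\<kappa> | c \<kappa> \<noteq> 0. of_int (c \<kappa>) * schur \<kappa>)"

definition lr_coeff :: "nat \<times> nat \<Rightarrow> nat \<times> nat \<Rightarrow> nat \<times> nat \<Rightarrow> int" where
  "lr_coeff lam \<mu> \<nu> = (THE c. LR_expansion \<mu> \<nu> c) lam"

section \<open>The polynomials \<open>q\<^sub>r\<close>, 2-reduced Schur polynomials and Schur's Q-polynomials\<close>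

text \<open>\<open>fps_left_inverse f 1\<close> is the multiplicative inverse of a power series \<open>f\<close> with constant
  term 1; \<^const>\<open>inverse\<close> is only available for coefficients in a field.\<close>

definition q_factor :: "nat \<Rightarrow> poly2 fps" where
  "q_factor i = (1 + fps_const (var i) * fps_X) * fps_left_inverse (1 - fps_const (var i) * fps_X) 1"

definition q :: "int \<Rightarrow> poly2" where
  "q r = (if r < 0 then 0 else fps_nth (\<Prod>i<2. q_factor i) (nat r))"

definition S :: "nat \<times> nat \<Rightarrow> poly2" where
  "S p = det (mat 2 2 (\<lambda>(i, j). q (int (part p i) - int i + int j)))"

definition qq :: "nat \<Rightarrow> poly2" where
  "qq r = fps_nth (\<Prod>i<2. (q_factor i)\<^sup>2) r"

definition QQ :: "nat \<times> nat \<Rightarrow> poly2" where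
  "QQ p = (case p of (r, s) \<Rightarrow>
     qq r * qq s + 2 * (\<Sum>i = 1..s. (- 1) ^ i * qq (r + i) * qq (s - i)))"

section \<open>The definitions are meaningful\<close>

lemma q_factor_mult:
  "q_factor i * (1 - fps_const (var i) * fps_X) = 1 + fps_const (var i) * fps_X"
proof -
  have "fps_left_inverse (1 - fps_const (var i) * fps_X) 1 * (1 - fps_const (var i) * fps_X) = 1"
    by (rule fps_left_inverse) simp
  then show ?thesis
    unfolding q_factor_def by (simp add: mult.assoc)
qed

abbreviation (input) "Y0 \<equiv> var 0"
abbreviation (input) "Y1 \<equiv> var 1"

lemma det_mat_2:
  fixes f :: "nat \<times> nat \<Rightarrow> 'a :: comm_ring_1"
  shows "det (mat 2 2 f) = f (0, 0) * f (1, 1) - f (0, 1) * f (1, 0)"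
proof -
  have "det (mat 2 2 f) = (\<Sum>j<2. mat 2 2 f $$ (0, j) * cofactor (mat 2 2 f) 0 j)"
    by (rule laplace_expansion_row) auto
  also have "\<dots> = f (0, 0) * f (1, 1) - f (0, 1) * f (1, 0)"
    by (simp add: cofactor_def numeral_2_eq_2) (simp add: det_single mat_delete_def)
  finally show ?thesis .
qed

lemma alternant_eq: "alternant (a, b) = Y0 ^ a * Y1 ^ b - Y0 ^ b * Y1 ^ a"
  unfolding alternant_def by (simp add: det_mat_2 part_def)

lemma alternant_delta: "alternant delta = Y0 - Y1"
  unfolding delta_def alternant_eq by simp

lemma alternant_delta_nonzero: "alternant delta \<noteq> 0"
  unfolding alternant_delta by (simp add: var_def)

lemma alternant_factor: "alternant (b + m, b) = (Y0 * Y1) ^ b * (Y0 ^ m - Y1 ^ m)"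
  unfolding alternant_eq by (simp add: power_add power_mult_distrib right_diff_distrib mult_ac)

lemma add_delta: "(a, b) + delta = (Suc a, b)"
  by (simp add: delta_def)

lemma alternant_add_delta:
  assumes "b \<le> a"
  shows "alternant ((a, b) + delta) =
    (\<Sum>i\<le>a - b. Y0 ^ i * Y1 ^ (a - b - i)) * (Y0 * Y1) ^ b * alternant delta"
proof -
  have "alternant ((a, b) + delta) = (Y0 * Y1) ^ b * (Y0 ^ Suc (a - b) - Y1 ^ Suc (a - b))"
    using alternant_factor[of b "Suc (a - b)"] assms by (simp add: add_delta)
  also have "Y0 ^ Suc (a - b) - Y1 ^ Suc (a - b) =
      (Y0 - Y1) * (\<Sum>i\<le>a - b. Y0 ^ i * Y1 ^ (a - b - i))"
    unfolding power_diff_sumr2 lessThan_Suc_atMost by (simp add: mult.commute)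
  finally show ?thesis
    by (simp only: alternant_delta mult_ac)
qed

lemma schur_eq:
  assumes "b \<le> a"
  shows "schur (a, b) = (\<Sum>i\<le>a - b. Y0 ^ i * Y1 ^ (a - b - i)) * (Y0 * Y1) ^ b"
  unfolding schur_def alternant_add_delta[OF assms]
  by (rule nonzero_mult_div_cancel_right) (rule alternant_delta_nonzero)

lemma schur_mult_alternant:
  assumes "p \<in> P2"
  shows "schur p * alternant delta = alternant (p + delta)"
proof -
  obtain a b where p: "p = (a, b)" by (cases p)
  have ba: "b \<le> a" using assms by (simp add: p P2_def)
  show ?thesis unfolding p schur_eq[OF ba] alternant_add_delta[OF ba] ..
qed

lemma coeff_alternant:
  "coeff (coeff (alternant (c, d)) b) a =
    (if (c, d) = (a, b) then 1 else 0) - (if (c, d) = (b, a) then 1 else 0)"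
proof -
  have *: "Y0 ^ m * Y1 ^ n = monom (monom 1 m) n" for m n
  proof -
    have "Y0 ^ m = [:monom 1 m:]"
      by (induction m) (auto simp: var_def monom_Suc one_pCons)
    moreover have "Y1 ^ n = monom 1 n"
      by (simp add: var_def monom_altdef)
    ultimately show ?thesis by (simp add: smult_monom)
  qed
  show ?thesis
    unfolding alternant_eq * coeff_diff coeff_monom
    by (cases "d = b"; cases "c = a"; cases "c = b"; cases "d = a"; simp)
qed

lemma schur_linear_independent:
  assumes fin: "finite A" and sub: "A \<subseteq> P2"
    and zero: "(\<Sum>\<kappa>\<in>A. of_int (c \<kappa>) * schur \<kappa>) = 0" and mem: "\<kappa> \<in> A"
  shows "c \<kappa> = 0"
proof -
  obtain a b where \<kappa>: "\<kappa> = (a, b)" by (cases \<kappa>)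
  have ab: "b \<le> a" using sub mem by (auto simp: \<kappa> P2_def)
  have "(\<Sum>p\<in>A. of_int (c p) * alternant (p + delta)) =
      (\<Sum>p\<in>A. of_int (c p) * schur p) * alternant delta"
    unfolding sum_distrib_right
    using sub by (intro sum.cong) (auto simp: schur_mult_alternant mult.assoc)
  then have 0: "(\<Sum>p\<in>A. of_int (c p) * alternant (p + delta)) = 0"
    using zero by simp
  have "0 = coeff (coeff (\<Sum>p\<in>A. of_int (c p) * alternant (p + delta)) b) (Suc a)"
    unfolding 0 by simp
  also have "\<dots> = (\<Sum>p\<in>A. of_int (c p) * coeff (coeff (alternant (p + delta)) b) (Suc a))"
    by (simp add: coeff_sum of_int_poly)
  also have "\<dots> = (\<Sum>p\<in>A. if p = \<kappa> then of_int (c p) else 0)"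
  proof (rule sum.cong)
    fix p assume "p \<in> A"
    moreover obtain r s where p: "p = (r, s)" by (cases p)
    ultimately have "s \<le> r" using sub by (auto simp: P2_def)
    then show "of_int (c p) * coeff (coeff (alternant (p + delta)) b) (Suc a) =
        (if p = \<kappa> then of_int (c p) else 0)"
      using ab by (auto simp: p \<kappa> delta_def coeff_alternant)
  qed simp
  also have "\<dots> = of_int (c \<kappa>)" using fin mem by simp
  finally show ?thesis by simp
qed

definition LR_summands :: "nat \<times> nat \<Rightarrow> nat \<times> nat \<Rightarrow> (nat \<times> nat) set" where
  "LR_summands \<mu> \<nu> = (\<lambda>k. (fst \<mu> + fst \<nu> - k, snd \<mu> + snd \<nu> + k)) `
     {..min (fst \<mu> - snd \<mu>) (fst \<nu> - snd \<nu>)}"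

lemma LR_summands_commute: "LR_summands \<mu> \<nu> = LR_summands \<nu> \<mu>"
  unfolding LR_summands_def by (simp add: add.commute min.commute)

lemma LR_summands_sub: "\<mu> \<in> P2 \<Longrightarrow> \<nu> \<in> P2 \<Longrightarrow> LR_summands \<mu> \<nu> \<subseteq> P2"
  unfolding LR_summands_def P2_def by auto

lemma schur_mult_aux:
  assumes "\<mu> \<in> P2" "\<nu> \<in> P2" "fst \<mu> - snd \<mu> \<le> fst \<nu> - snd \<nu>"
  shows "schur \<mu> * schur \<nu> = (\<Sum>\<kappa>\<in>LR_summands \<mu> \<nu>. schur \<kappa>)"
proof -
  obtain a b where \<mu>: "\<mu> = (a, b)" by (cases \<mu>)
  obtain a' b' where \<nu>: "\<nu> = (a', b')" by (cases \<nu>)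
  define d where "d = a - b"
  define e where "e = a' - b'"
  have a: "a = b + d" and a': "a' = b' + e" and de: "d \<le> e"
    using assms by (auto simp: \<mu> \<nu> P2_def d_def e_def)
  have "schur \<mu> * schur \<nu> * alternant delta = schur \<mu> * alternant (\<nu> + delta)"
    using assms by (simp add: mult.assoc schur_mult_alternant)
  also have "\<dots> = (\<Sum>i\<le>d. Y0 ^ i * Y1 ^ (d - i)) * (Y0 * Y1) ^ b *
      (Y0 ^ (b' + e + 1) * Y1 ^ b' - Y0 ^ b' * Y1 ^ (b' + e + 1))"
    by (simp add: \<mu> \<nu> a a' schur_eq delta_def alternant_eq)
  also have "\<dots> = (\<Sum>i\<le>d. Y0 ^ (b + b' + e + 1 + i) * Y1 ^ (b + b' + (d - i))) -
      (\<Sum>i\<le>d. Y0 ^ (b + b' + i) * Y1 ^ (b + b' + e + 1 + (d - i)))"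
    unfolding right_diff_distrib sum_distrib_right
    by (simp only: power_add power_mult_distrib mult_ac)
  also have "(\<Sum>i\<le>d. Y0 ^ (b + b' + e + 1 + i) * Y1 ^ (b + b' + (d - i))) =
      (\<Sum>k\<le>d. Y0 ^ (b + b' + e + 1 + (d - k)) * Y1 ^ (b + b' + k))"
    by (rule sum.reindex_bij_witness[of _ "\<lambda>i. d - i" "\<lambda>i. d - i"]) auto
  also have "\<dots> - (\<Sum>k\<le>d. Y0 ^ (b + b' + k) * Y1 ^ (b + b' + e + 1 + (d - k))) =
      (\<Sum>k\<le>d. alternant ((a + a' - k, b + b' + k) + delta))"
    unfolding sum_subtractf[symmetric]
    by (rule sum.cong) (auto simp: a a' delta_def alternant_eq algebra_simps Suc_diff_le)
  also have "\<dots> = (\<Sum>k\<le>d. schur (a + a' - k, b + b' + k)) * alternant delta"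
    unfolding sum_distrib_right using de
    by (intro sum.cong refl schur_mult_alternant[symmetric]) (auto simp: P2_def a a')
  also have "(\<Sum>k\<le>d. schur (a + a' - k, b + b' + k)) = (\<Sum>\<kappa>\<in>LR_summands \<mu> \<nu>. schur \<kappa>)"
    using de unfolding LR_summands_def
    by (subst sum.reindex) (auto simp: inj_on_def \<mu> \<nu> a a' min_def)
  finally show ?thesis
    using alternant_delta_nonzero by simp
qed

lemma schur_mult:
  assumes "\<mu> \<in> P2" "\<nu> \<in> P2"
  shows "schur \<mu> * schur \<nu> = (\<Sum>\<kappa>\<in>LR_summands \<mu> \<nu>. schur \<kappa>)"
proof (cases "fst \<mu> - snd \<mu> \<le> fst \<nu> - snd \<nu>")
  case True
  then show ?thesis using assms by (intro schur_mult_aux)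
next
  case False
  then show ?thesis
    using schur_mult_aux[of \<nu> \<mu>] assms by (simp add: mult.commute LR_summands_commute)
qed

lemma LR_expansion_exists:
  assumes "\<mu> \<in> P2" "\<nu> \<in> P2"
  shows "LR_expansion \<mu> \<nu> (\<lambda>\<kappa>. if \<kappa> \<in> LR_summands \<mu> \<nu> then 1 else 0)"
proof -
  have "finite (LR_summands \<mu> \<nu>)" by (simp add: LR_summands_def)
  then show ?thesis
    using schur_mult[OF assms] LR_summands_sub[OF assms]
    unfolding LR_expansion_def by simp
qed

lemma LR_expansion_unique:
  assumes "LR_expansion \<mu> \<nu> c" "LR_expansion \<mu> \<nu> c'"
  shows "c = c'"
proof
  fix \<kappa>
  define A where "A = {\<kappa>. c \<kappa> \<noteq> 0} \<union> {\<kappa>. c' \<kappa> \<noteq> 0}"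
  have A: "finite A" "A \<subseteq> P2" using assms by (auto simp: A_def LR_expansion_def)
  have *: "(\<Sum>\<kappa> | f \<kappa> \<noteq> 0. of_int (f \<kappa>) * schur \<kappa>) = (\<Sum>\<kappa>\<in>A. of_int (f \<kappa>) * schur \<kappa>)"
    if "{\<kappa>. f \<kappa> \<noteq> 0} \<subseteq> A" for f :: "nat \<times> nat \<Rightarrow> int"
    using A that by (intro sum.mono_neutral_left) auto
  have "(\<Sum>\<kappa>\<in>A. of_int (c \<kappa>) * schur \<kappa>) = (\<Sum>\<kappa>\<in>A. of_int (c' \<kappa>) * schur \<kappa>)"
    using assms *[of c] *[of c'] by (simp add: LR_expansion_def A_def)
  then have "(\<Sum>\<kappa>\<in>A. of_int (c \<kappa> - c' \<kappa>) * schur \<kappa>) = 0"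
    by (simp add: left_diff_distrib sum_subtractf)
  then have "c \<kappa> - c' \<kappa> = 0" if "\<kappa> \<in> A"
    using schur_linear_independent[OF A, of "\<lambda>\<kappa>. c \<kappa> - c' \<kappa>" \<kappa>] that by simp
  then show "c \<kappa> = c' \<kappa>" by (cases "\<kappa> \<in> A") (auto simp: A_def)
qed

lemma LR_expansion_ex1: "\<mu> \<in> P2 \<Longrightarrow> \<nu> \<in> P2 \<Longrightarrow> \<exists>!c. LR_expansion \<mu> \<nu> c"
  using LR_expansion_exists LR_expansion_unique by blast

lemma lr_coeff_eq:
  assumes "\<mu> \<in> P2" "\<nu> \<in> P2"
  shows "lr_coeff lam \<mu> \<nu> = (if lam \<in> LR_summands \<mu> \<nu> then 1 else 0)"
proof -
  have "(THE c. LR_expansion \<mu> \<nu> c) = (\<lambda>\<kappa>. if \<kappa> \<in> LR_summands \<mu> \<nu> then 1 else 0)"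
    by (rule the_equality)
       (use LR_expansion_exists[OF assms] LR_expansion_unique in blast)+
  then show ?thesis by (simp add: lr_coeff_def)
qed

text \<open>A sum over \<open>\<mu>, \<nu> \<in> P2\<close> weighted by \<open>c\<^sup>\<lambda>\<^sub>\<mu>\<^sub>\<nu>\<close> has only finitely many nonzero terms, so
  it may be written as a sum over the following finite set.\<close>

lemma finite_lr_support: "finite {(\<mu>, \<nu>). \<mu> \<in> P2 \<and> \<nu> \<in> P2 \<and> lr_coeff lam \<mu> \<nu> \<noteq> 0}"
proof (rule finite_subset)
  let ?B = "{..fst lam + snd lam} \<times> {..fst lam + snd lam}"
  have "(\<mu>, \<nu>) \<in> ?B \<times> ?B"
    if "\<mu> \<in> P2" "\<nu> \<in> P2" "lr_coeff lam \<mu> \<nu> \<noteq> 0" for \<mu> \<nu>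
  proof -
    have "lam \<in> LR_summands \<mu> \<nu>"
      using that(3) unfolding lr_coeff_eq[OF that(1,2)] by (simp split: if_splits)
    then obtain k where "lam = (fst \<mu> + fst \<nu> - k, snd \<mu> + snd \<nu> + k)" "k \<le> fst \<mu> - snd \<mu>"
      by (auto simp: LR_summands_def)
    then have "fst lam + snd lam = fst \<mu> + fst \<nu> + snd \<mu> + snd \<nu>"
      by simp
    then show ?thesis by (simp add: mem_Times_iff)
  qed
  then show "{(\<mu>, \<nu>). \<mu> \<in> P2 \<and> \<nu> \<in> P2 \<and> lr_coeff lam \<mu> \<nu> \<noteq> 0} \<subseteq> ?B \<times> ?B"
    by blast
  show "finite (?B \<times> ?B)" by simp
qed

end

theory Submission
  imports Defs
begin

text \<open>The proof compares generating functions in two variables \<open>z\<^sub>1, z\<^sub>2\<close>.  Split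
  \<open>G(t) = \<Sum>\<^sub>r q\<^sub>r t\<^sup>r\<close> as \<open>E(t\<^sup>2) + t O(t\<^sup>2)\<close>, and write \<open>E\<^sub>i = E(z\<^sub>i)\<close>, \<open>O\<^sub>i = O(z\<^sub>i)\<close>.  If \<open>(a, b) = \<mu> + \<delta>\<close>,
  the rows of the determinant \<open>S\<^bsub>2\<mu>+\<Delta>\<^esub>\<close> are \<open>(q\<^bsub>2a\<^esub>, q\<^bsub>2a+1\<^esub>)\<close> and \<open>(q\<^bsub>2b\<^esub>, q\<^bsub>2b+1\<^esub>)\<close>, so \<open>S\<^bsub>2\<mu>+\<Delta>\<^esub>\<close>
  is the coefficient of \<open>z\<^sub>1\<^sup>a z\<^sub>2\<^sup>b\<close> in \<open>E\<^sub>1 O\<^sub>2 - O\<^sub>1 E\<^sub>2\<close>.  Likewise \<open>S\<^bsub>2\<mu>+\<delta>\<^esub>\<close> is the coefficient in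
  \<open>z\<^sub>1 O\<^sub>1 E\<^sub>2 - z\<^sub>2 E\<^sub>1 O\<^sub>2\<close> (\<open>S_dbl_add_Delta\<close>, \<open>S_dbl_add_delta\<close>).

  Both series change sign when \<open>z\<^sub>1\<close> and \<open>z\<^sub>2\<close> are exchanged.  An antisymmetric series with
  coefficients \<open>g\<close> is \<open>(z\<^sub>1 - z\<^sub>2) \<Sum>\<^sub>\<mu> g(\<mu> + \<delta>) s\<^sub>\<mu>(z)\<close>, so by the definition of
  \<open>c\<^sup>\<lambda>\<^sub>\<mu>\<^sub>\<nu>\<close> the product of two of them, divided by \<open>z\<^sub>1 - z\<^sub>2\<close>, is antisymmetric and has the
  Littlewood--Richardson sum as its coefficient at \<open>\<lambda> + \<delta>\<close>.  Expanding \<open>1 / (z\<^sub>1 - z\<^sub>2)\<close> in powers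
  of \<open>z\<^sub>2 / z\<^sub>1\<close> writes that coefficient as a sum of coefficients of the product along an
  antidiagonal (\<open>lr_sum_antisymmetric_arrays\<close>).

  Since \<open>G(t) G(-t) = 1\<close>, that is \<open>E(z)\<^sup>2 - z O(z)\<^sup>2 = 1\<close>, the series \<open>E\<^sup>2\<close>, \<open>z O\<^sup>2\<close> and \<open>E O\<close> are, up to
  the factor 2 and the constant term, the even and odd parts of \<open>G\<^sup>2 = \<Sum>\<^sub>r q\<^sub>r(x,x) t\<^sup>r\<close>
  (\<open>even_odd_part_square\<close>).  Hence, up to boundary terms, 4 times a coefficient of the product is a combination of
  three products \<open>q\<^sub>r(x,x) q\<^sub>s(x,x)\<close>, which by \<open>QQ_diff_QQ\<close> is a difference of two
  Q-polynomials; the antidiagonal sum telescopes to a single one.\<close>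

section \<open>Littlewood--Richardson sums of antisymmetric arrays\<close>

text \<open>In two variables Littlewood--Richardson coefficients are 0 or 1.  The shift \<open>k\<close> that
  describes the summands of \<open>s\<^sub>\<mu> s\<^sub>\<nu>\<close> is determined by \<open>\<lambda>\<^sub>2\<close>; eliminating it leaves bounds on
  \<open>\<lambda>\<^sub>2\<close>, in terms of the same sums of parts that appear in \<open>sum_antisymmetric_pairs\<close>.\<close>

lemma lr_coeff_conv_bounds:
  assumes "\<mu> \<in> P2" "\<nu> \<in> P2" "lam \<in> P2"
  shows "lr_coeff lam \<mu> \<nu> =
    (if fst \<mu> + snd \<mu> + (fst \<nu> + snd \<nu>) = fst lam + snd lam \<and> snd \<mu> + snd \<nu> \<le> snd lam \<and>
        snd lam \<le> fst \<mu> + snd \<nu> \<and> snd lam \<le> snd \<mu> + fst \<nu> then 1 else 0)"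
proof -
  obtain a b where \<mu>: "\<mu> = (a, b)" by (cases \<mu>)
  obtain c d where \<nu>: "\<nu> = (c, d)" by (cases \<nu>)
  obtain i j where lam: "lam = (i, j)" by (cases lam)
  have le: "b \<le> a" "d \<le> c" "j \<le> i" using assms by (auto simp: \<mu> \<nu> lam P2_def)
  have "lam \<in> LR_summands \<mu> \<nu> \<longleftrightarrow>
      a + b + (c + d) = i + j \<and> b + d \<le> j \<and> j \<le> a + d \<and> j \<le> b + c"
  proof
    assume "a + b + (c + d) = i + j \<and> b + d \<le> j \<and> j \<le> a + d \<and> j \<le> b + c"
    then have "lam = (a + c - (j - (b + d)), b + d + (j - (b + d)))"
      "j - (b + d) \<le> min (a - b) (c - d)"
      using le by (auto simp: lam)
    then show "lam \<in> LR_summands \<mu> \<nu>" by (auto simp: LR_summands_def \<mu> \<nu>)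
  qed (use le in \<open>auto simp: LR_summands_def \<mu> \<nu> lam\<close>)
  then show ?thesis unfolding lr_coeff_eq[OF assms(1,2)] by (simp add: \<mu> \<nu> lam)
qed

lemma sum_split_involution:
  fixes F :: "'b \<Rightarrow> 'a :: comm_monoid_add"
  assumes fin: "finite X"
    and inv: "\<And>x. x \<in> X \<Longrightarrow> \<sigma> x \<in> X" "\<And>x. x \<in> X \<Longrightarrow> \<sigma> (\<sigma> x) = x"
    and disj: "\<And>x. x \<in> X \<Longrightarrow> P x \<Longrightarrow> \<not> P (\<sigma> x)"
    and zero: "\<And>x. x \<in> X \<Longrightarrow> \<not> P x \<Longrightarrow> \<not> P (\<sigma> x) \<Longrightarrow> F x = 0"
  shows "sum F X = (\<Sum>x | x \<in> X \<and> P x. F x + F (\<sigma> x))"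
proof -
  have "sum F X = sum F ({x\<in>X. P x} \<union> {x\<in>X. P (\<sigma> x)})"
    using fin zero by (intro sum.mono_neutral_right) auto
  also have "\<dots> = sum F {x\<in>X. P x} + sum F {x\<in>X. P (\<sigma> x)}"
    using fin disj by (intro sum.union_disjoint) auto
  also have "sum F {x\<in>X. P (\<sigma> x)} = (\<Sum>x\<in>{x\<in>X. P x}. F (\<sigma> x))"
    by (rule sum.reindex_bij_witness[of _ \<sigma> \<sigma>]) (use inv in auto)
  finally show ?thesis by (simp add: sum.distrib)
qed

text \<open>Each index pair is brought into decreasing order, by one application of
  \<open>sum_split_involution\<close> per pair; the four signed weights come from the two swaps.\<close>

lemma sum_antisymmetric_pairs:
  fixes g h :: "nat \<times> nat \<Rightarrow> 'a :: comm_ring_1" and w :: "nat \<Rightarrow> 'a"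
  assumes fin: "finite U"
    and swap1: "\<And>a b y. ((a, b), y) \<in> U \<Longrightarrow> ((b, a), y) \<in> U"
    and swap2: "\<And>x c d. (x, (c, d)) \<in> U \<Longrightarrow> (x, (d, c)) \<in> U"
    and g: "\<And>a b. g (b, a) = - g (a, b)" "\<And>a. g (a, a) = 0"
    and h: "\<And>a b. h (b, a) = - h (a, b)" "\<And>a. h (a, a) = 0"
  shows "(\<Sum>((a, b), (c, d))\<in>U. g (a, b) * h (c, d) * w (b + d)) =
    (\<Sum>((a, b), (c, d)) | ((a, b), (c, d)) \<in> U \<and> b < a \<and> d < c.
       g (a, b) * h (c, d) * (w (b + d) - w (a + d) - w (b + c) + w (a + c)))"
    (is "?l = ?r")
proof -
  define V where "V = {x \<in> U. snd (fst x) < fst (fst x)}"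
  define k where "k b a d = w (b + d) - w (a + d)" for b a d
  define F where "F = (\<lambda>((a, b), (c, d)). g (a, b) * h (c, d) * w (b + d))"
  define F' where "F' = (\<lambda>((a, b), (c, d)). g (a, b) * h (c, d) * k b a d)"
  let ?s1 = "\<lambda>x :: (nat \<times> nat) \<times> nat \<times> nat. (prod.swap (fst x), snd x)"
  let ?s2 = "\<lambda>x :: (nat \<times> nat) \<times> nat \<times> nat. (fst x, prod.swap (snd x))"
  have zero1: "F x = 0" if "\<not> snd (fst x) < fst (fst x)" "\<not> snd (fst (?s1 x)) < fst (fst (?s1 x))" for x
  proof -
    have "fst (fst x) = snd (fst x)" using that by simp
    then show ?thesis by (cases x) (auto simp: F_def g(2))
  qed
  have zero2: "F' x = 0" if "\<not> snd (snd x) < fst (snd x)" "\<not> snd (snd (?s2 x)) < fst (snd (?s2 x))" for x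
  proof -
    have "fst (snd x) = snd (snd x)" using that by simp
    then show ?thesis by (cases x) (auto simp: F'_def h(2))
  qed
  have add1: "F x + F (?s1 x) = F' x" for x
    using g(1)[of "fst (fst x)" "snd (fst x)"] by (cases x) (auto simp: F_def F'_def k_def algebra_simps)
  have add2: "F' x + F' (?s2 x) = (case x of ((a, b), (c, d)) \<Rightarrow>
       g (a, b) * h (c, d) * (w (b + d) - w (a + d) - w (b + c) + w (a + c)))" for x
    using h(1)[of "fst (snd x)" "snd (snd x)"] by (cases x) (auto simp: F'_def k_def algebra_simps)
  have "?l = sum F U" by (simp add: F_def)
  also have "\<dots> = (\<Sum>x\<in>V. F x + F (?s1 x))"
    unfolding V_def using swap1
    by (intro sum_split_involution[OF fin] zero1) (auto intro: swap1 simp: prod.swap_def)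
  also have "\<dots> = sum F' V" by (simp only: add1)
  also have "\<dots> = (\<Sum>x | x \<in> V \<and> snd (snd x) < fst (snd x). F' x + F' (?s2 x))"
    using fin by (intro sum_split_involution zero2) (auto simp: V_def intro: swap2)
  also have "\<dots> = ?r"
    unfolding add2 by (rule sum.cong) (auto simp: V_def)
  finally show ?thesis .
qed

text \<open>The right-hand side is the coefficient of \<open>z\<^sub>1\<^sup>i z\<^sub>2\<^sup>j\<close>, with \<open>(i, j) = \<lambda> + \<delta>\<close>, in the
  product of the generating functions of \<open>g\<close> and \<open>h\<close>, times
  \<open>1 / (z\<^sub>1 - z\<^sub>2) = \<Sum>\<^sub>k z\<^sub>2\<^sup>k / z\<^sub>1\<^bsup>k+1\<^esup>\<close>; the total degree to extract is \<open>N = i + j + 1\<close>.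

  The identity holds because weighting all index pairs by \<open>[b + d \<le> \<lambda>\<^sub>2]\<close> and ordering them
  leaves the weight \<open>[b + d \<le> \<lambda>\<^sub>2] - [a + d \<le> \<lambda>\<^sub>2] - [b + c \<le> \<lambda>\<^sub>2] + [a + c \<le> \<lambda>\<^sub>2]\<close> on the pairs
  \<open>(a, b) = \<mu> + \<delta>\<close>, \<open>(c, d) = \<nu> + \<delta>\<close>, which is \<open>c\<^sup>\<lambda>\<^sub>\<mu>\<^sub>\<nu>\<close>.  Indeed \<open>a + b + c + d > 2 \<lambda>\<^sub>2 + 1\<close>, so the
  last bracket and at least one of the two middle ones vanish.\<close>

lemma lr_sum_antisymmetric_arrays:
  fixes g h :: "nat \<times> nat \<Rightarrow> 'a :: comm_ring_1"
  assumes lam: "lam \<in> P2"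
    and g: "\<And>a b. g (b, a) = - g (a, b)" "\<And>a. g (a, a) = 0"
    and h: "\<And>a b. h (b, a) = - h (a, b)" "\<And>a. h (a, a) = 0"
  defines "N \<equiv> fst lam + snd lam + 2"
  shows "(\<Sum>(\<mu>, \<nu>) \<in> {(\<mu>, \<nu>). \<mu> \<in> P2 \<and> \<nu> \<in> P2 \<and> lr_coeff lam \<mu> \<nu> \<noteq> 0}.
            of_int (lr_coeff lam \<mu> \<nu>) * g (\<mu> + delta) * h (\<nu> + delta)) =
    (\<Sum>s\<le>snd lam. \<Sum>a\<le>N - s. \<Sum>b\<le>s. g (a, b) * h (N - s - a, s - b))"
    (is "?l = ?r")
proof -
  define U where "U = {((a, b), (c, d)). a + b + (c + d) = N}"
  define w :: "nat \<Rightarrow> 'a" where "w s = of_bool (s \<le> snd lam)" for s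
  define R where "R = {((a, b), (c, d)). ((a, b), (c, d)) \<in> U \<and> b < a \<and> d < c}"
  have "U \<subseteq> ({..N} \<times> {..N}) \<times> ({..N} \<times> {..N})" by (auto simp: U_def)
  then have fin: "finite U" by (rule finite_subset) auto
  have jN: "snd lam < N" by (simp add: N_def)
  define \<omega> where "\<omega> = (\<lambda>((a, b), (c, d)). w (b + d) - w (a + d) - w (b + c) + w (a + c))"
  \<comment> \<open>Pairs in \<open>R\<close> that belong to no \<open>(\<mu>, \<nu>)\<close> with nonzero coefficient have weight 0.\<close>
  have "?l = (\<Sum>(l, m)\<in>R. g l * h m * \<omega> (l, m))"
  proof (rule sum.reindex_bij_witness_not_neutral[where i = "\<lambda>(l, m). (l - delta, m - delta)"
        and j = "\<lambda>(\<mu>, \<nu>). (\<mu> + delta, \<nu> + delta)" and S' = "{}" and T' = "{x \<in> R. \<omega> x = 0}"])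
    show "finite {x \<in> R. \<omega> x = 0}"
      by (rule finite_subset[OF _ fin]) (auto simp: R_def)
  qed (use lam in \<open>auto simp: R_def U_def P2_def delta_def N_def w_def \<omega>_def lr_coeff_conv_bounds
         of_bool_def split: if_splits\<close>)
  also have "\<dots> = (\<Sum>((a, b), (c, d))\<in>U. g (a, b) * h (c, d) * w (b + d))"
  proof -
    have swap1: "((b, a), y) \<in> U" if "((a, b), y) \<in> U" for a b y
      using that by (auto simp: U_def)
    have swap2: "(x, (d, c)) \<in> U" if "(x, (c, d)) \<in> U" for x c d
      using that by (auto simp: U_def)
    have "(\<Sum>(l, m)\<in>R. g l * h m * \<omega> (l, m)) =
      (\<Sum>((a, b), (c, d)) | ((a, b), (c, d)) \<in> U \<and> b < a \<and> d < c.
         g (a, b) * h (c, d) * (w (b + d) - w (a + d) - w (b + c) + w (a + c)))"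
      by (rule sum.cong) (auto simp: R_def \<omega>_def)
    also have "\<dots> = (\<Sum>((a, b), (c, d))\<in>U. g (a, b) * h (c, d) * w (b + d))"
      by (rule sum_antisymmetric_pairs[where U = U and g = g and h = h and w = w,
            OF fin swap1 swap2 g h, symmetric])
    finally show ?thesis .
  qed
  also have "\<dots> = (\<Sum>((a, b), (c, d)) | ((a, b), (c, d)) \<in> U \<and> b + d \<le> snd lam. g (a, b) * h (c, d))"
    using fin by (intro sum.mono_neutral_cong_right) (auto simp: w_def of_bool_def split: if_splits)
  also have "\<dots> = (\<Sum>(s, a, b)\<in>(SIGMA s:{..snd lam}. {..N - s} \<times> {..s}).
      g (a, b) * h (N - s - a, s - b))"
    by (rule sum.reindex_bij_witness[where i = "\<lambda>(s, a, b). ((a, b), (N - s - a, s - b))"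
          and j = "\<lambda>((a, b), (c, d)). (b + d, a, b)"])
       (use jN in \<open>auto simp: U_def\<close>)
  also have "\<dots> = ?r"
    by (simp add: sum.Sigma sum.cartesian_product split_beta)
  finally show ?thesis .
qed

lemma sum_det_mult_det:
  fixes A B C D :: "'a :: comm_ring_1 fps"
  shows "(\<Sum>a\<le>r. \<Sum>b\<le>s. (fps_nth A a * fps_nth B b - fps_nth B a * fps_nth A b) *
      (fps_nth C (r - a) * fps_nth D (s - b) - fps_nth D (r - a) * fps_nth C (s - b))) =
    fps_nth (A * C) r * fps_nth (B * D) s - fps_nth (A * D) r * fps_nth (B * C) s
    - fps_nth (B * C) r * fps_nth (A * D) s + fps_nth (B * D) r * fps_nth (A * C) s"
  unfolding fps_mult_nth atLeast0AtMost sum_product sum_subtractf[symmetric] sum.distrib[symmetric]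
  by (intro sum.cong refl) (simp add: algebra_simps)

section \<open>Even and odd parts of a power series with \<open>G(t) G(-t) = 1\<close>\<close>

definition even_part :: "'a :: zero fps \<Rightarrow> 'a fps" where
  "even_part G = Abs_fps (\<lambda>l. fps_nth G (2 * l))"

definition odd_part :: "'a :: zero fps \<Rightarrow> 'a fps" where
  "odd_part G = Abs_fps (\<lambda>l. fps_nth G (2 * l + 1))"

lemma fps_nth_compose_uminus_X:
  fixes F :: "'a :: comm_ring_1 fps"
  shows "fps_nth (F oo - fps_X) n = (- 1) ^ n * fps_nth F n"
proof -
  have "fps_nth ((- fps_X :: 'a fps) ^ i) n = (if i = n then (- 1) ^ n else 0)" for i
  proof -
    have "(- fps_X :: 'a fps) ^ i = fps_const ((- 1) ^ i) * fps_X ^ i"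
      by (subst power_minus) (simp flip: fps_const_power fps_const_neg)
    then show ?thesis by (simp add: fps_X_power_nth)
  qed
  then show ?thesis by (simp add: fps_compose_nth mult_delta_right mult.commute)
qed

lemma sum_atMost_double:
  fixes f :: "nat \<Rightarrow> 'a :: comm_monoid_add"
  shows "(\<Sum>k\<le>2 * n. f k) = (\<Sum>a\<le>n. f (2 * a)) + (\<Sum>a<n. f (2 * a + 1))"
  by (induction n) (simp_all add: ac_simps)

lemma sum_atMost_Suc_double:
  fixes f :: "nat \<Rightarrow> 'a :: comm_monoid_add"
  shows "(\<Sum>k\<le>2 * n + 1. f k) = (\<Sum>a\<le>n. f (2 * a)) + (\<Sum>a\<le>n. f (2 * a + 1))"
  by (induction n) (simp_all add: ac_simps)

text \<open>Comparing \<open>F G\<close> with \<open>(F\<^sub>0(t\<^sup>2) + t F\<^sub>1(t\<^sup>2)) (G\<^sub>0(t\<^sup>2) + t G\<^sub>1(t\<^sup>2))\<close>, its even part is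
  \<open>F\<^sub>0 G\<^sub>0 + z F\<^sub>1 G\<^sub>1\<close> and its odd part \<open>F\<^sub>0 G\<^sub>1 + F\<^sub>1 G\<^sub>0\<close>.\<close>

lemma fps_nth_mult_double:
  fixes F G :: "'a :: comm_ring_1 fps"
  shows "fps_nth (F * G) (2 * n) = fps_nth (even_part F * even_part G) n +
    fps_nth (fps_X * (odd_part F * odd_part G)) n"
proof (cases n)
  case (Suc m)
  have "(\<Sum>a<n. fps_nth F (2 * a + 1) * fps_nth G (2 * n - (2 * a + 1))) =
      (\<Sum>a\<le>m. fps_nth F (2 * a + 1) * fps_nth G (2 * (m - a) + 1))"
    unfolding Suc lessThan_Suc_atMost
    by (intro sum.cong arg_cong2[of _ _ _ _ "(*)"] arg_cong[of _ _ "fps_nth G"] refl) auto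
  moreover have "fps_nth (fps_X * (odd_part F * odd_part G)) n = fps_nth (odd_part F * odd_part G) m"
    by (simp add: Suc)
  moreover have "fps_nth F (2 * a) * fps_nth G (2 * n - 2 * a) = fps_nth F (2 * a) * fps_nth G (2 * (n - a))"
    for a by (simp add: diff_mult_distrib2)
  ultimately show ?thesis
    unfolding fps_mult_nth[of F] atLeast0AtMost sum_atMost_double
    by (simp only: fps_mult_nth even_part_def odd_part_def atLeast0AtMost fps_nth_Abs_fps)
qed (simp add: even_part_def odd_part_def)

lemma fps_nth_mult_Suc_double:
  fixes F G :: "'a :: comm_ring_1 fps"
  shows "fps_nth (F * G) (2 * n + 1) = fps_nth (even_part F * odd_part G) n +
    fps_nth (odd_part F * even_part G) n"
proof -
  have "(\<Sum>a\<le>n. fps_nth F (2 * a) * fps_nth G (2 * n + 1 - 2 * a)) =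
      (\<Sum>a\<le>n. fps_nth F (2 * a) * fps_nth G (2 * (n - a) + 1))"
    by (intro sum.cong arg_cong2[of _ _ _ _ "(*)"] arg_cong[of _ _ "fps_nth G"] refl) auto
  then show ?thesis
    unfolding fps_mult_nth[of F] atLeast0AtMost sum_atMost_Suc_double
    by (simp add: fps_mult_nth even_part_def odd_part_def atLeast0AtMost diff_mult_distrib2)
qed

text \<open>With \<open>E\<close> and \<open>O\<close> the two parts of \<open>G\<close>, the even part of \<open>G\<^sup>2\<close> is \<open>E\<^sup>2 + z O\<^sup>2\<close>, and
  the hypothesis says \<open>E\<^sup>2 - z O\<^sup>2 = 1\<close>; adding and subtracting isolates \<open>E\<^sup>2\<close> and \<open>z O\<^sup>2\<close>.\<close>

lemma even_odd_part_square:
  fixes G :: "'a :: comm_ring_1 fps"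
  assumes "G * (G oo - fps_X) = 1"
  shows "2 * fps_nth (even_part G * even_part G) n = fps_nth (G\<^sup>2) (2 * n) + of_bool (n = 0)"
    and "2 * fps_nth (fps_X * (odd_part G * odd_part G)) n = fps_nth (G\<^sup>2) (2 * n) - of_bool (n = 0)"
    and "2 * fps_nth (even_part G * odd_part G) n = fps_nth (G\<^sup>2) (2 * n + 1)"
proof -
  have even: "even_part (G oo - fps_X) = even_part G"
    by (simp add: even_part_def fps_nth_compose_uminus_X)
  have odd: "odd_part (G oo - fps_X) = - odd_part G"
    by (simp add: odd_part_def fps_nth_compose_uminus_X fps_eq_iff)
  have "of_bool (n = 0) = fps_nth (G * (G oo - fps_X)) (2 * n)"
    by (simp add: assms)
  also have "\<dots> = fps_nth (even_part G * even_part G) n - fps_nth (fps_X * (odd_part G * odd_part G)) n"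
    unfolding fps_nth_mult_double even odd mult_minus_right fps_neg_nth by (rule add_uminus_conv_diff)
  finally have *: "of_bool (n = 0) = fps_nth (even_part G * even_part G) n
      - fps_nth (fps_X * (odd_part G * odd_part G)) n" .
  have "2 * x = x + y + (x - y)" "2 * y = x + y - (x - y)" for x y :: 'a
    by (simp_all add: algebra_simps)
  then show "2 * fps_nth (even_part G * even_part G) n = fps_nth (G\<^sup>2) (2 * n) + of_bool (n = 0)"
    and "2 * fps_nth (fps_X * (odd_part G * odd_part G)) n = fps_nth (G\<^sup>2) (2 * n) - of_bool (n = 0)"
    unfolding power2_eq_square fps_nth_mult_double * by blast+
  show "2 * fps_nth (even_part G * odd_part G) n = fps_nth (G\<^sup>2) (2 * n + 1)"
    unfolding power2_eq_square fps_nth_mult_Suc_double by (simp add: mult.commute)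
qed

section \<open>The generating function of the polynomials \<open>q\<^sub>r\<close>\<close>

definition q_series :: "poly2 fps" where
  "q_series = (\<Prod>i<2. q_factor i)"

lemma q_nat: "q (int n) = fps_nth q_series n"
  by (simp add: q_def q_series_def)

lemma qq_eq: "qq n = fps_nth (q_series\<^sup>2) n"
  by (simp add: qq_def q_series_def prod_power_distrib)

text \<open>Replacing \<open>t\<close> by \<open>-t\<close> exchanges the numerator and the denominator of
  \<open>(1 + x\<^sub>i t) / (1 - x\<^sub>i t)\<close>.\<close>

lemma q_factor_uminus: "q_factor i * (q_factor i oo - fps_X) = 1"
proof -
  let ?c = "fps_const (var i) * fps_X"
  have "(q_factor i * (1 - ?c)) oo - fps_X = (1 + ?c) oo - fps_X"
    by (simp only: q_factor_mult)
  then have flip: "(q_factor i oo - fps_X) * (1 + ?c) = 1 - ?c"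
    by (simp add: fps_compose_mult_distrib fps_compose_add_distrib fps_compose_sub_distrib)
  have "q_factor i * (q_factor i oo - fps_X) * ((1 - ?c) * (1 + ?c)) =
      (q_factor i * (1 - ?c)) * ((q_factor i oo - fps_X) * (1 + ?c))"
    by (simp only: mult_ac)
  also have "\<dots> = 1 * ((1 - ?c) * (1 + ?c))"
    unfolding q_factor_mult flip by (simp only: mult_1_left mult.commute)
  finally have eq: "q_factor i * (q_factor i oo - fps_X) * ((1 - ?c) * (1 + ?c)) =
      1 * ((1 - ?c) * (1 + ?c))" .
  have "fps_nth ((1 - ?c) * (1 + ?c)) 0 \<noteq> 0" by simp
  then have "(1 - ?c) * (1 + ?c) \<noteq> 0" by (metis fps_zero_nth)
  with eq show ?thesis by (simp only: mult_cancel_right) auto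
qed

lemma q_series_uminus: "q_series * (q_series oo - fps_X) = 1"
  by (simp add: q_series_def fps_compose_prod_distrib q_factor_uminus flip: prod.distrib)

text \<open>In terms of \<open>(a, b) = p + \<delta>\<close> the two rows of the determinant have the same shape: their
  indices are \<open>2a, 2a + 1\<close> and \<open>2b, 2b + 1\<close>.\<close>

lemma S_dbl_add_Delta:
  fixes p :: "nat \<times> nat"
  defines "ev \<equiv> even_part q_series" and "od \<equiv> odd_part q_series" and "l \<equiv> p + delta"
  shows "S (dbl p + Delta) =
    fps_nth ev (fst l) * fps_nth od (snd l) - fps_nth od (fst l) * fps_nth ev (snd l)"
proof -
  obtain a b where p: "p = (a, b)" by (cases p)
  have "q (3 + 2 * int a) = fps_nth q_series (2 * a + 3)"
    using q_nat[of "2 * a + 3"] by (simp add: add_ac)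
  moreover have "q (2 + 2 * int a) = fps_nth q_series (2 * a + 2)"
    using q_nat[of "2 * a + 2"] by (simp add: add_ac)
  moreover have "q (1 + 2 * int b) = fps_nth q_series (2 * b + 1)"
    using q_nat[of "2 * b + 1"] by (simp add: add_ac)
  moreover have "q (2 * int b) = fps_nth q_series (2 * b)"
    using q_nat[of "2 * b"] by simp
  ultimately show ?thesis
    by (simp add: S_def det_mat_2 p l_def ev_def od_def even_part_def odd_part_def dbl_def Delta_def
        delta_def part_def add_ac numeral_3_eq_3)
qed

text \<open>Here the indices in the rows are \<open>2a - 1, 2a\<close> and \<open>2b - 1, 2b\<close>.  The factor \<open>z\<close> in front of
  the odd part shifts its coefficients by one, and its constant term 0 is \<open>q\<^sub>r\<close> at \<open>r = -1\<close>.\<close>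

lemma S_dbl_add_delta:
  fixes p :: "nat \<times> nat"
  defines "ev \<equiv> even_part q_series" and "xod \<equiv> fps_X * odd_part q_series" and "l \<equiv> p + delta"
  shows "S (dbl p + delta) =
    fps_nth xod (fst l) * fps_nth ev (snd l) - fps_nth ev (fst l) * fps_nth xod (snd l)"
proof -
  obtain a b where p: "p = (a, b)" by (cases p)
  have "q (2 + 2 * int a) = fps_nth q_series (2 * a + 2)"
    using q_nat[of "2 * a + 2"] by (simp add: add_ac)
  moreover have "q (1 + 2 * int a) = fps_nth q_series (2 * a + 1)"
    using q_nat[of "2 * a + 1"] by (simp add: add_ac)
  moreover have "q (2 * int b) = fps_nth q_series (2 * b)"
    using q_nat[of "2 * b"] by simp
  moreover have "q (2 * int b - 1) = (if b = 0 then 0 else fps_nth q_series (2 * (b - 1) + 1))"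
  proof (cases b)
    case (Suc c)
    then show ?thesis using q_nat[of "2 * c + 1"] by simp
  qed (simp add: q_def)
  ultimately show ?thesis
    by (simp add: S_def det_mat_2 p l_def ev_def xod_def even_part_def odd_part_def dbl_def
        delta_def part_def add_ac)
qed

section \<open>Telescoping of Schur's Q-polynomials\<close>

lemma qq_0: "qq 0 = 1"
proof -
  have "fps_nth (q_factor i) 0 = 1" for i by (simp add: q_factor_def)
  then show ?thesis by (simp add: qq_def power2_eq_square numeral_2_eq_2)
qed

lemma QQ_0_right: "QQ (r, 0) = qq r"
  by (simp add: QQ_def qq_0)

text \<open>This is \<open>(t\<^sub>1 + t\<^sub>2) \<Sum> Q\<^sub>r\<^sub>s t\<^sub>1\<^sup>r t\<^sub>2\<^sup>s = (t\<^sub>1 - t\<^sub>2) (G(t\<^sub>1)\<^sup>2 G(t\<^sub>2)\<^sup>2 - 1)\<close> read off coefficientwise: the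
  alternating sums of the two Q-polynomials cancel, except for the term \<open>i = 1\<close> of the first.\<close>

lemma QQ_add_QQ: "QQ (r, Suc s) + QQ (Suc r, s) = qq r * qq (Suc s) - qq (Suc r) * qq s"
proof -
  have "(\<Sum>i = 1..Suc s. (- 1) ^ i * qq (r + i) * qq (Suc s - i)) =
      (\<Sum>i = 0..s. (- 1) ^ Suc i * qq (r + Suc i) * qq (s - i))"
    by (rule sum.reindex_bij_witness[of _ Suc "\<lambda>i. i - 1"]) auto
  also have "\<dots> = - (qq (Suc r) * qq s) - (\<Sum>i = 1..s. (- 1) ^ i * qq (Suc r + i) * qq (s - i))"
    by (simp add: sum.atLeast_Suc_atMost sum_negf)
  finally show ?thesis unfolding QQ_def by (simp add: algebra_simps)
qed

lemma QQ_diff_QQ: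
  "QQ (r, s + 2) - QQ (r + 2, s) = qq r * qq (s + 2) - 2 * (qq (r + 1) * qq (s + 1)) + qq (r + 2) * qq s"
  using QQ_add_QQ[of r "Suc s"] QQ_add_QQ[of "Suc r" s] by (simp add: algebra_simps)

section \<open>Littlewood--Richardson sums of 2-reduced Schur polynomials\<close>

lemma lr_sum_det:
  fixes A B C D :: "'a :: comm_ring_1 fps"
  assumes lam: "lam \<in> P2"
  defines "N \<equiv> fst lam + snd lam + 2"
  shows "(\<Sum>(\<mu>, \<nu>) \<in> {(\<mu>, \<nu>). \<mu> \<in> P2 \<and> \<nu> \<in> P2 \<and> lr_coeff lam \<mu> \<nu> \<noteq> 0}.
            of_int (lr_coeff lam \<mu> \<nu>)
            * (fps_nth A (fst (\<mu> + delta)) * fps_nth B (snd (\<mu> + delta))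
               - fps_nth B (fst (\<mu> + delta)) * fps_nth A (snd (\<mu> + delta)))
            * (fps_nth C (fst (\<nu> + delta)) * fps_nth D (snd (\<nu> + delta))
               - fps_nth D (fst (\<nu> + delta)) * fps_nth C (snd (\<nu> + delta)))) =
    (\<Sum>s\<le>snd lam. fps_nth (A * C) (N - s) * fps_nth (B * D) s
      - fps_nth (A * D) (N - s) * fps_nth (B * C) s
      - fps_nth (B * C) (N - s) * fps_nth (A * D) s
      + fps_nth (B * D) (N - s) * fps_nth (A * C) s)"
proof -
  define d :: "'a fps \<Rightarrow> 'a fps \<Rightarrow> nat \<times> nat \<Rightarrow> 'a" where
    "d = (\<lambda>A B l. fps_nth A (fst l) * fps_nth B (snd l) - fps_nth B (fst l) * fps_nth A (snd l))"
  have d: "d A B (b, a) = - d A B (a, b)" "d A B (a, a) = 0" for A B a b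
    by (simp_all add: d_def mult.commute)
  show ?thesis
    using lr_sum_antisymmetric_arrays[OF lam, of "d A B" "d C D", OF d d]
    unfolding N_def[symmetric] d_def fst_conv snd_conv sum_det_mult_det .
qed

text \<open>The relevant product is \<open>(E\<^sub>1 O\<^sub>2 - O\<^sub>1 E\<^sub>2)\<^sup>2 = E\<^sub>1\<^sup>2 O\<^sub>2\<^sup>2 - 2 E\<^sub>1 O\<^sub>1 E\<^sub>2 O\<^sub>2 + O\<^sub>1\<^sup>2 E\<^sub>2\<^sup>2\<close>.\<close>

lemma lr_sum_Delta_Delta:
  assumes lam: "lam \<in> P2"
  shows "4 * (\<Sum>(\<mu>, \<nu>) \<in> {(\<mu>, \<nu>). \<mu> \<in> P2 \<and> \<nu> \<in> P2 \<and> lr_coeff lam \<mu> \<nu> \<noteq> 0}.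
            of_int (lr_coeff lam \<mu> \<nu>) * S (dbl \<mu> + Delta) * S (dbl \<nu> + Delta))
         = QQ (dbl lam + dbl Delta)"
proof -
  define ev where "ev = even_part q_series"
  define od where "od = odd_part q_series"
  define N where "N = fst lam + snd lam + 2"
  note sq = even_odd_part_square[OF q_series_uminus, folded ev_def od_def qq_eq]
  have oo: "2 * fps_nth (od * od) n = qq (2 * n + 2)" for n
    using sq(2)[of "Suc n"] by simp
  define P where "P r s = fps_nth (ev * ev) r * fps_nth (od * od) s
      - fps_nth (ev * od) r * fps_nth (od * ev) s
      - fps_nth (od * ev) r * fps_nth (ev * od) s
      + fps_nth (od * od) r * fps_nth (ev * ev) s" for r s
  \<comment> \<open>The summand 1 in \<open>2 E\<^sup>2 = 1 + E\<^sup>2 + z O\<^sup>2\<close> contributes the extra term for \<open>s = 0\<close>; it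
    cancels the Q-polynomial left over at the end of the telescoping sum.\<close>
  have P: "4 * P r s = QQ (2 * r, 2 * s + 2) - QQ (2 * r + 2, 2 * s) + of_bool (s = 0) * qq (2 * r + 2)"
    if "r > 0" for r s
  proof -
    have "4 * P r s = (2 * fps_nth (ev * ev) r) * (2 * fps_nth (od * od) s)
      - 2 * ((2 * fps_nth (ev * od) r) * (2 * fps_nth (ev * od) s))
      + (2 * fps_nth (od * od) r) * (2 * fps_nth (ev * ev) s)"
      by (simp add: P_def algebra_simps)
    also have "\<dots> = QQ (2 * r, 2 * s + 2) - QQ (2 * r + 2, 2 * s) + of_bool (s = 0) * qq (2 * r + 2)"
      unfolding sq oo QQ_diff_QQ using that by (simp add: algebra_simps)
    finally show ?thesis .
  qed
  have tele: "(\<Sum>s\<le>j. 4 * P (N - s) s) = QQ (2 * (N - j), 2 * j + 2)" if "j < N" for j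
    using that
  proof (induction j)
    case 0
    then show ?case by (simp add: P QQ_0_right)
  next
    case (Suc j)
    then have "2 * (N - Suc j) + 2 = 2 * (N - j)" by simp
    with Suc show ?case by (simp add: P)
  qed
  have "4 * (\<Sum>(\<mu>, \<nu>) \<in> {(\<mu>, \<nu>). \<mu> \<in> P2 \<and> \<nu> \<in> P2 \<and> lr_coeff lam \<mu> \<nu> \<noteq> 0}.
            of_int (lr_coeff lam \<mu> \<nu>) * S (dbl \<mu> + Delta) * S (dbl \<nu> + Delta)) =
      (\<Sum>s\<le>snd lam. 4 * P (N - s) s)"
    unfolding S_dbl_add_Delta lr_sum_det[OF lam] ev_def[symmetric] od_def[symmetric]
      N_def[symmetric] P_def sum_distrib_left ..
  also have "\<dots> = QQ (2 * (N - snd lam), 2 * snd lam + 2)"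
    by (rule tele) (simp add: N_def)
  also have "(2 * (N - snd lam), 2 * snd lam + 2) = dbl lam + dbl Delta"
    by (simp add: N_def dbl_def Delta_def prod_eq_iff)
  finally show ?thesis .
qed

text \<open>The relevant product is \<open>(z\<^sub>1 O\<^sub>1 E\<^sub>2 - z\<^sub>2 E\<^sub>1 O\<^sub>2) (E\<^sub>1 O\<^sub>2 - O\<^sub>1 E\<^sub>2)\<close>.  If \<open>F\<close> is the even
  part of \<open>G\<^sup>2\<close>, then \<open>2 E\<^sup>2 = F + 1\<close> and \<open>2 z O\<^sup>2 = F - 1\<close>; the opposite constants cancel in
  \<open>(F\<^sub>1 - 1)(F\<^sub>2 + 1) + (F\<^sub>1 + 1)(F\<^sub>2 - 1)\<close>, except in degree \<open>(0, 0)\<close>.\<close>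

lemma lr_sum_delta_Delta:
  assumes lam: "lam \<in> P2"
  shows "4 * (\<Sum>(\<mu>, \<nu>) \<in> {(\<mu>, \<nu>). \<mu> \<in> P2 \<and> \<nu> \<in> P2 \<and> lr_coeff lam \<mu> \<nu> \<noteq> 0}.
            of_int (lr_coeff lam \<mu> \<nu>) * S (dbl \<mu> + delta) * S (dbl \<nu> + Delta))
         = QQ (dbl lam + Delta + delta)"
proof -
  define ev where "ev = even_part q_series"
  define od where "od = odd_part q_series"
  define xod where "xod = fps_X * od"
  define N where "N = fst lam + snd lam + 2"
  note sq = even_odd_part_square[OF q_series_uminus, folded ev_def od_def qq_eq]
  have xoe: "2 * fps_nth (xod * ev) n = (if n = 0 then 0 else qq (2 * n - 1))" for n
    using sq(3)[of "n - 1"] by (cases n) (simp_all add: xod_def mult_ac)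
  have xoo: "2 * fps_nth (xod * od) n = qq (2 * n) - of_bool (n = 0)" for n
    using sq(2)[of n] by (simp add: xod_def mult_ac)
  define P where "P r s = fps_nth (xod * ev) r * fps_nth (ev * od) s
      - fps_nth (xod * od) r * fps_nth (ev * ev) s
      - fps_nth (ev * ev) r * fps_nth (xod * od) s
      + fps_nth (ev * od) r * fps_nth (xod * ev) s" for r s
  have P4: "4 * P r s = (2 * fps_nth (xod * ev) r) * (2 * fps_nth (ev * od) s)
      - (2 * fps_nth (xod * od) r) * (2 * fps_nth (ev * ev) s)
      - (2 * fps_nth (ev * ev) r) * (2 * fps_nth (xod * od) s)
      + (2 * fps_nth (ev * od) r) * (2 * fps_nth (xod * ev) s)" for r s
    by (simp add: P_def algebra_simps)
  have P0: "4 * P (Suc r) 0 = QQ (2 * r + 1, 1)" for r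
    using QQ_add_QQ[of "2 * r + 1" 0] unfolding P4 sq xoe xoo
    by (simp add: QQ_0_right qq_0 algebra_simps)
  have P_Suc: "4 * P (Suc r) (Suc s) = QQ (2 * r + 1, 2 * s + 3) - QQ (2 * r + 3, 2 * s + 1)" for r s
    using QQ_diff_QQ[of "2 * r + 1" "2 * s + 1"] unfolding P4 sq xoe xoo
    by (simp add: numeral_3_eq_3 algebra_simps)
  have tele: "(\<Sum>s\<le>j. 4 * P (N - s) s) = QQ (2 * (N - j) - 1, 2 * j + 1)" if "j < N" for j
    using that
  proof (induction j)
    case 0
    then obtain r where "N = Suc r" by (cases N) auto
    then show ?case by (simp add: P0)
  next
    case (Suc j)
    then obtain r where r: "N - Suc j = Suc r" by (cases "N - Suc j") auto
    have "2 * (N - j) - 1 = 2 * r + 3" "2 * Suc j + 1 = 2 * j + 3" "2 * (N - Suc j) - 1 = 2 * r + 1"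
      using r by simp_all
    with Suc r show ?case by (simp add: P_Suc numeral_3_eq_3)
  qed
  have "4 * (\<Sum>(\<mu>, \<nu>) \<in> {(\<mu>, \<nu>). \<mu> \<in> P2 \<and> \<nu> \<in> P2 \<and> lr_coeff lam \<mu> \<nu> \<noteq> 0}.
            of_int (lr_coeff lam \<mu> \<nu>) * S (dbl \<mu> + delta) * S (dbl \<nu> + Delta)) =
      (\<Sum>s\<le>snd lam. 4 * P (N - s) s)"
    unfolding S_dbl_add_Delta S_dbl_add_delta lr_sum_det[OF lam] ev_def[symmetric] od_def[symmetric]
      xod_def[symmetric] N_def[symmetric] P_def sum_distrib_left ..
  also have "\<dots> = QQ (2 * (N - snd lam) - 1, 2 * snd lam + 1)"
    by (rule tele) (simp add: N_def)
  also have "(2 * (N - snd lam) - 1, 2 * snd lam + 1) = dbl lam + Delta + delta"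
    by (simp add: N_def dbl_def Delta_def delta_def prod_eq_iff)
  finally show ?thesis .
qed

theorem theorem5p1:
  fixes lam :: "nat \<times> nat"
  assumes "lam \<in> P2"
  shows "(\<Sum>(\<mu>, \<nu>) \<in> {(\<mu>, \<nu>). \<mu> \<in> P2 \<and> \<nu> \<in> P2 \<and> lr_coeff lam \<mu> \<nu> \<noteq> 0}.
            of_int (lr_coeff lam \<mu> \<nu>) * S (dbl \<mu> + Delta) * S (dbl \<nu> + Delta))
         = [:[:1 / 2 ^ 2:]:] * QQ (dbl lam + dbl Delta)
    \<and> (\<Sum>(\<mu>, \<nu>) \<in> {(\<mu>, \<nu>). \<mu> \<in> P2 \<and> \<nu> \<in> P2 \<and> lr_coeff lam \<mu> \<nu> \<noteq> 0}.
            of_int (lr_coeff lam \<mu> \<nu>) * S (dbl \<mu> + delta) * S (dbl \<nu> + Delta))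
         = [:[:1 / 2 ^ 2:]:] * QQ (dbl lam + Delta + delta)"
proof -
  have "[:[:1 / 2 ^ 2:]:] * (4 :: poly2) = 1"
    by (simp add: numeral_poly one_pCons)
  then have quarter: "[:[:1 / 2 ^ 2:]:] * (4 * x) = x" for x :: poly2
    by (simp only: mult.assoc[symmetric] mult_1_left)
  show ?thesis
    by (simp only: lr_sum_Delta_Delta[OF assms, symmetric] lr_sum_delta_Delta[OF assms, symmetric] quarter)
qed

end
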